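(* Let $A,B,C,a,b\in\mathbb{R}$ and let $\{F_n\}$ be the sequence of real numbers defined by $F_0=a$, $F_1=b$ and $$F_{n+2}=A+BF_{n+1}+CF_n\qquad (n\ge 0).$$ If $|B|<2$ and $C=-1$, then $\{F_n\}$ is a periodic sequence with period $T=\frac{2\pi}{\omega}$, where $\omega=\arccos\frac{B}{2}$, and $T>2$.
   Context: $\arccos$ denotes the principal branch, with values in $[0,\pi]$. *)

theory Defs
  imports "HOL-Analysis.Analysis" "HOL-Library.Periodic_Fun"
begin

text \<open>
  A sequence with a possibly non-integer period \<open>T\<close>: the values \<open>F n\<close> are samples, at the
  natural numbers, of a continuous \<open>T\<close>-periodic function on the reals. The usual condition
  \<open>F (n + T) = F n\<close> only makes sense when \<open>T\<close> is an integer, and then it is equivalent to the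
  present one (see \<open>seq_period_of_nat_iff\<close> below).

  Continuity cannot be dropped: if \<open>T\<close> is irrational, then distinct naturals are distinct
  modulo \<open>T\<close>, so every sequence whatsoever would extend to some \<open>T\<close>-periodic function.

  A period need not be minimal; in particular constant sequences have every \<open>T > 0\<close> as a
  period.
\<close>
definition seq_period :: "(nat \<Rightarrow> real) \<Rightarrow> real \<Rightarrow> bool" where
  "seq_period F T \<longleftrightarrow> T > 0 \<and>
     (\<exists>f :: real \<Rightarrow> real. continuous_on UNIV f \<and> periodic_fun_simple f T \<and>
        (\<forall>n. F n = f (real n)))"

lemma seq_period_shift:
  assumes "seq_period F T" and "real m = real n + of_int k * T"
  shows "F m = F n"
proof -
  obtain f :: "real \<Rightarrow> real" where f: "periodic_fun_simple f T" "\<forall>n. F n = f (real n)"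
    using assms(1) unfolding seq_period_def by blast
  interpret periodic_fun_simple f T by (rule f(1))
  show ?thesis
    using f(2) assms(2) plus_of_int[of "real n" k] by simp
qed

lemma seq_period_of_nat_iff:
  "seq_period F (real p) \<longleftrightarrow> p > 0 \<and> (\<forall>n. F (n + p) = F n)"
proof
  assume P: "seq_period F (real p)"
  then have "p > 0" by (simp add: seq_period_def)
  moreover have "F (n + p) = F n" for n
    by (rule seq_period_shift[OF P, of _ _ 1]) simp
  ultimately show "p > 0 \<and> (\<forall>n. F (n + p) = F n)" by blast
next
  assume A: "p > 0 \<and> (\<forall>n. F (n + p) = F n)"
  then have p: "p > 0" and per: "\<And>n. F (n + p) = F n" by auto
  have Fmod: "F n = F (n mod p)" for n
  proof -
    have "F (r + q * p) = F r" for q r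
    proof (induction q)
      case (Suc q)
      have "F (r + Suc q * p) = F ((r + q * p) + p)" by (simp add: algebra_simps)
      then show ?case using per Suc by metis
    qed simp
    from this[of "n mod p" "n div p"] show ?thesis by simp
  qed
  define s where "s x = (sin (pi * x / real p))\<^sup>2" for x :: real
  define h where "h x = (\<Prod>j\<in>{1..<p}. s (x - real j) / s (real j))" for x :: real
  define f where "f x = (\<Sum>i<p. F i * h (x - real i))" for x :: real
  have s_per: "s (x + real p) = s x" for x
  proof -
    have "pi * (x + real p) / real p = pi * x / real p + pi"
      using p by (simp add: field_simps)
    then show ?thesis by (simp add: s_def)
  qed
  have s_zero: "s (of_int m) = 0 \<longleftrightarrow> int p dvd m" for m
  proof -
    have "s (of_int m) = 0 \<longleftrightarrow> (\<exists>i::int. pi * of_int m / real p = of_int i * pi)"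
      unfolding s_def by (simp add: sin_zero_iff_int2)
    also have "\<dots> \<longleftrightarrow> (\<exists>i::int. real_of_int m = real_of_int (int p * i))"
      using p by (simp add: field_simps)
    also have "\<dots> \<longleftrightarrow> int p dvd m"
      by (simp only: of_int_eq_iff dvd_def)
    finally show ?thesis .
  qed
  have s_even: "s (- x) = s x" for x
    by (simp add: s_def)
  have h_at: "h (real n - real i) = (if n mod p = i then 1 else 0)" if i: "i < p" for n i
  proof (cases "n mod p = i")
    case True
    have "s (real n - real i - real j) / s (real j) = 1" if j: "j \<in> {1..<p}" for j
    proof -
      have nz: "s (real j) \<noteq> 0"
        using s_zero[of "int j"] j by (auto dest: zdvd_imp_le)
      have s_mult: "s (x + real q * real p) = s x" for x q
      proof (induction q)
        case (Suc q)
        have "s (x + real (Suc q) * real p) = s ((x + real q * real p) + real p)"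
          by (simp add: algebra_simps)
        then show ?case using s_per Suc by metis
      qed simp
      have "n = i + (n div p) * p" using True by (metis mod_mult_div_eq add.commute mult.commute)
      then have "real n = real i + real (n div p) * real p"
        by (metis of_nat_add of_nat_mult)
      then have "s (real n - real i - real j) = s (- real j + real (n div p) * real p)"
        by simp
      also have "\<dots> = s (real j)" by (simp only: s_mult s_even)
      finally show ?thesis using nz by simp
    qed
    then have "h (real n - real i) = 1" unfolding h_def by (intro prod.neutral) blast
    then show ?thesis using True by simp
  next
    case False
    define j where "j = nat ((int n - int i) mod int p)"
    have j: "int j = (int n - int i) mod int p" using p by (simp add: j_def)
    have "int j \<noteq> 0"
    proof
      assume "int j = 0"
      then have "int n mod int p = int i mod int p"
        using j by (simp add: mod_eq_dvd_iff dvd_eq_mod_eq_0)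
      then have "n mod p = i mod p" by (simp flip: of_nat_mod)
      with False i show False by simp
    qed
    moreover have "int j < int p" using p j by simp
    ultimately have jin: "j \<in> {1..<p}" by auto
    have "int p dvd (int n - int i) - int j"
      unfolding j by (simp add: minus_mod_eq_mult_div)
    then have "s (real_of_int (int n - int i - int j)) = 0" using s_zero by blast
    then have "s (real n - real i - real j) = 0" by simp
    then have "h (real n - real i) = 0"
      unfolding h_def using jin by (intro prod_zero) auto
    then show ?thesis using False by simp
  qed
  have "continuous_on UNIV f"
    unfolding f_def h_def s_def divide_inverse by (intro continuous_intros)
  moreover have "periodic_fun_simple f (real p)"
  proof
    fix x
    have "h (x + real p - real i) = h (x - real i)" for i
      unfolding h_def using s_per[of "x - real i - real j" for j]
      by (simp add: algebra_simps)
    then show "f (x + real p) = f x" by (simp add: f_def)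
  qed
  moreover have "F n = f (real n)" for n
  proof -
    have "f (real n) = (\<Sum>i<p. if n mod p = i then F i else 0)"
      unfolding f_def by (intro sum.cong) (auto simp: h_at)
    also have "\<dots> = F (n mod p)" using p by simp
    finally show ?thesis using Fmod by simp
  qed
  ultimately show "seq_period F (real p)"
    unfolding seq_period_def using p by auto
qed

end

theory Submission
  imports Defs
begin

text \<open>
  With \<open>B = 2 cos \<omega>\<close> and \<open>0 < \<omega> < \<pi>\<close>, the sum-to-product formulas show that \<open>cos (\<omega> n)\<close> and
  \<open>sin (\<omega> n)\<close> solve the homogeneous recurrence, and the constant \<open>A / (2 - B)\<close> solves the
  inhomogeneous one. As \<open>sin \<omega> \<noteq> 0\<close>, a combination of the three matches both initial values,
  and it is the restriction to the naturals of a continuous function of period \<open>2 \<pi> / \<omega>\<close>.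
\<close>

definition harmonic :: "real \<Rightarrow> real \<Rightarrow> real \<Rightarrow> real \<Rightarrow> real \<Rightarrow> real" where
  "harmonic \<omega> p c d x = p + c * cos (\<omega> * x) + d * sin (\<omega> * x)"

lemma continuous_on_harmonic: "continuous_on S (harmonic \<omega> p c d)"
  unfolding harmonic_def by (intro continuous_intros)

lemma periodic_harmonic:
  assumes "\<omega> \<noteq> 0"
  shows "periodic_fun_simple (harmonic \<omega> p c d) (2 * pi / \<omega>)"
proof
  fix x
  have "\<omega> * (x + 2 * pi / \<omega>) = \<omega> * x + 2 * pi"
    using assms by (simp add: field_simps)
  then show "harmonic \<omega> p c d (x + 2 * pi / \<omega>) = harmonic \<omega> p c d x"
    by (simp add: harmonic_def)
qed

lemma harmonic_recurrence:
  "harmonic \<omega> p c d (x + 2) =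
     (2 - 2 * cos \<omega>) * p + 2 * cos \<omega> * harmonic \<omega> p c d (x + 1) - harmonic \<omega> p c d x"
proof -
  \<comment> \<open>Centred at the middle point, the outer arguments are y \<plusminus> \<omega>, so
    the sine cross terms cancel when the outer values are added.\<close>
  define y where "y = \<omega> * (x + 1)"
  have arg: "\<omega> * (x + 2) = y + \<omega>" "\<omega> * (x + 1) = y" "\<omega> * x = y - \<omega>"
    by (simp_all add: y_def algebra_simps)
  show ?thesis
    unfolding harmonic_def arg cos_add cos_diff sin_add sin_diff by algebra
qed

theorem proposition3:
  fixes A B C a b :: real and F :: "nat \<Rightarrow> real" and \<omega> T :: real
  assumes "F 0 = a" and "F 1 = b"
    and "\<And>n. F (n + 2) = A + B * F (n + 1) + C * F n"
    and "\<bar>B\<bar> < 2" and "C = -1"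
    and "\<omega> = arccos (B / 2)" and "T = 2 * pi / \<omega>"
  shows "seq_period F T \<and> T > 2"
proof -
  have \<omega>: "0 < \<omega>" "\<omega> < pi" and B: "B = 2 * cos \<omega>"
    using arccos_lt_bounded[of "B / 2"] cos_arccos[of "B / 2"] assms(4,6) by auto
  have sin_pos: "sin \<omega> > 0" using \<omega> by (rule sin_gt_zero)
  define p where "p = A / (2 - B)"
  \<comment> \<open>The value a at 0 forces the cosine coefficient a - p; d then solves p + (a - p)
    cos \<omega> + d sin \<omega> = b.\<close>
  define d where "d = (b - p - (a - p) * cos \<omega>) / sin \<omega>"
  let ?f = "harmonic \<omega> p (a - p) d"
  have A: "A = (2 - 2 * cos \<omega>) * p"
    using assms(4) B by (simp add: p_def)
  have "F n = ?f (real n) \<and> F (n + 1) = ?f (real (n + 1))" for n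
  proof (induction n)
    case 0
    show ?case
      using assms(1,2) sin_pos by (simp add: harmonic_def d_def)
  next
    case (Suc n)
    have "F (n + 2) = A + B * ?f (real n + 1) - ?f (real n)"
      using Suc assms(3)[of n] assms(5) by (simp add: add.commute)
    also have "\<dots> = ?f (real n + 2)"
      unfolding harmonic_recurrence A B ..
    finally show ?case
      using Suc by (simp add: add.commute)
  qed
  then have "\<forall>n. F n = ?f (real n)" by blast
  \<comment> \<open>Equivalent to \<omega> < \<pi>, which is strict because B > -2.\<close>
  moreover have "T > 2"
    unfolding assms(7) using \<omega> by (simp add: less_divide_eq)
  ultimately show ?thesis
    unfolding seq_period_def assms(7)
    using continuous_on_harmonic[of UNIV \<omega> p "a - p" d]
      periodic_harmonic[of \<omega> p "a - p" d] \<omega> by auto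
qed

end
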